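(* The mixing time of the lazy random walk on the grid $[k]^n$ is $\tau=O(k^2\,n\,\log^2 n)$; that is, there is an absolute constant $C$ such that for all integers $k\ge2$ and $n\ge2$, $$\tau(1/4)\ \le\ C\,k^2\,n\,(\log n)^2 .$$
   Context: $[k]=\{1,\dots,k\}$. The lazy random walk on the line $[k]$ moves from a point to each of its existing neighbours (at distance $1$) with probability $1/4$ and holds with the remaining probability; its stationary distribution is uniform. The lazy random walk on the grid $[k]^n$ is the product chain: choose one of the $n$ coordinates uniformly at random and move that coordinate by one step of the lazy walk on $[k]$. The stationary distribution $\pi$ is uniform on $[k]^n$. With $P$ the transition matrix, $\|p-\pi\|_{TV}=\frac12\sum_v|p(v)-\pi(v)|$ and $\tau(\epsilon)=\max_{p^{(0)}}\min\{t:\|p^{(0)}P^t-\pi\|_{TV}\le\epsilon\}$, where the maximum is over initial distributions; $\tau$ denotes $\tau(1/4)$. *)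

theory Defs
  imports "HOL-Analysis.Analysis"
begin

text \<open>
  A Markov chain on a finite state space \<open>S\<close> is given by \<open>S\<close> and its transition matrix
  \<open>P\<close>, where \<open>P u v\<close> is the probability of moving from \<open>u\<close> to \<open>v\<close>; only the entries and
  values indexed by elements of \<open>S\<close> are meaningful.
\<close>

definition distributions :: "'a set \<Rightarrow> ('a \<Rightarrow> real) set" where
  "distributions S = {p. (\<forall>v\<in>S. p v \<ge> 0) \<and> (\<Sum>v\<in>S. p v) = 1}"

definition uniform_dist :: "'a set \<Rightarrow> 'a \<Rightarrow> real" where
  "uniform_dist S = (\<lambda>v. 1 / real (card S))"

definition tv_dist :: "'a set \<Rightarrow> ('a \<Rightarrow> real) \<Rightarrow> ('a \<Rightarrow> real) \<Rightarrow> real" where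
  "tv_dist S p q = (\<Sum>v\<in>S. \<bar>p v - q v\<bar>) / 2"

text \<open>The row vector \<open>p P\<close>.\<close>

definition chain_step :: "'a set \<Rightarrow> ('a \<Rightarrow> 'a \<Rightarrow> real) \<Rightarrow> ('a \<Rightarrow> real) \<Rightarrow> 'a \<Rightarrow> real" where
  "chain_step S P p = (\<lambda>v. \<Sum>u\<in>S. p u * P u v)"

text \<open>
  The mixing time \<open>\<tau>(\<epsilon>)\<close> with respect to the stationary distribution \<open>\<pi>\<close>. It is an extended
  natural number: a start from which the distance never drops to \<open>\<epsilon>\<close> contributes \<open>\<infinity>\<close>
  (an infimum over the empty set), and so does an unbounded set of times. A finite value is
  attained, so that the supremum and the infimum are then a maximum and a minimum.
\<close>

definition mixing_time ::
    "'a set \<Rightarrow> ('a \<Rightarrow> 'a \<Rightarrow> real) \<Rightarrow> ('a \<Rightarrow> real) \<Rightarrow> real \<Rightarrow> enat" where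
  "mixing_time S P \<pi> \<epsilon> =
     (SUP p\<in>distributions S. INF t\<in>{t. tv_dist S ((chain_step S P ^^ t) p) \<pi> \<le> \<epsilon>}. enat t)"

definition line_nbrs :: "nat \<Rightarrow> nat \<Rightarrow> nat set" where
  "line_nbrs k x = {y \<in> {1..k}. y = x + 1 \<or> x = y + 1}"

definition lazy_line :: "nat \<Rightarrow> nat \<Rightarrow> nat \<Rightarrow> real" where
  "lazy_line k x y =
     (if y \<in> line_nbrs k x then 1 / 4
      else if y = x then 1 - real (card (line_nbrs k x)) / 4
      else 0)"

text \<open>
  The product of \<open>n\<close> copies of a chain \<open>P\<close>: a uniformly chosen coordinate \<open>i\<close> makes one step.
  The condition \<open>y = x(i := y i)\<close> says that \<open>x\<close> and \<open>y\<close> agree off \<open>i\<close>.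
\<close>

definition product_chain ::
    "nat \<Rightarrow> ('a \<Rightarrow> 'a \<Rightarrow> real) \<Rightarrow> (nat \<Rightarrow> 'a) \<Rightarrow> (nat \<Rightarrow> 'a) \<Rightarrow> real" where
  "product_chain n P x y =
     (\<Sum>i\<in>{1..n}. 1 / real n * (if y = x(i := y i) then P (x i) (y i) else 0))"

definition grid :: "nat \<Rightarrow> nat \<Rightarrow> (nat \<Rightarrow> nat) set" where
  "grid k n = {1..n} \<rightarrow>\<^sub>E {1..k}"

definition lazy_grid :: "nat \<Rightarrow> nat \<Rightarrow> (nat \<Rightarrow> nat) \<Rightarrow> (nat \<Rightarrow> nat) \<Rightarrow> real" where
  "lazy_grid k n = product_chain n (lazy_line k)"

definition grid_mixing_time :: "nat \<Rightarrow> nat \<Rightarrow> real \<Rightarrow> enat" where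
  "grid_mixing_time k n \<epsilon> = mixing_time (grid k n) (lazy_grid k n) (uniform_dist (grid k n)) \<epsilon>"

end

theory Submission
  imports Defs
begin

text \<open>
  By duality it suffices to bound the oscillation of \<open>P\<^sup>t f\<close> for \<open>\<bar>f\<bar> \<le> 1\<close>, and by telescoping
  it suffices to compare \<open>P\<^sup>t f\<close> at two points that differ in a single coordinate. Move the two
  points together off that coordinate; on it, let one of the two, chosen by a fair coin, make a
  non-lazy step, so that they cannot cross. With \<open>d\<close> the distance of the two points, the function
  \<open>d (2 k - d)\<close> decreases by at least \<open>1 / n\<close> in expectation per step, so the expected
  meeting time is at most \<open>n k\<^sup>2\<close>, and by Markov's inequality \<open>2 n k\<^sup>2\<close> steps halve the oscillation
  in each coordinate. Hence \<open>O(log n)\<close> such blocks suffice.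
\<close>

section \<open>Duality for symmetric chains\<close>

text \<open>The action of \<open>P\<close> on functions, adjoint to \<open>chain_step\<close> for
  the pairing of \<open>p\<close> and \<open>f\<close> by summation over \<open>S\<close>.\<close>

definition chain_op :: "'a set \<Rightarrow> ('a \<Rightarrow> 'a \<Rightarrow> real) \<Rightarrow> ('a \<Rightarrow> real) \<Rightarrow> 'a \<Rightarrow> real" where
  "chain_op S P f = (\<lambda>x. \<Sum>y\<in>S. P x y * f y)"

lemma sum_chain_step:
  "(\<Sum>v\<in>S. chain_step S P p v * f v) = (\<Sum>u\<in>S. p u * chain_op S P f u)"
  unfolding chain_step_def chain_op_def sum_distrib_left sum_distrib_right
  by (subst sum.swap) (simp add: mult_ac)

lemma sum_chain_step_funpow:
  "(\<Sum>v\<in>S. (chain_step S P ^^ t) p v * f v) = (\<Sum>u\<in>S. p u * (chain_op S P ^^ t) f u)"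
proof (induction t arbitrary: f)
  case (Suc t)
  have "(\<Sum>v\<in>S. (chain_step S P ^^ Suc t) p v * f v)
      = (\<Sum>u\<in>S. (chain_step S P ^^ t) p u * chain_op S P f u)"
    by (simp add: sum_chain_step)
  also have "\<dots> = (\<Sum>u\<in>S. p u * (chain_op S P ^^ Suc t) f u)"
    by (simp add: Suc.IH funpow_swap1)
  finally show ?case .
qed simp

text \<open>By symmetry the column sums of \<open>P\<close> are row sums, hence 1, so counting
  measure is invariant.\<close>

lemma sum_chain_op_symmetric:
  assumes sym: "\<And>x y. x \<in> S \<Longrightarrow> y \<in> S \<Longrightarrow> P x y = P y x"
    and one: "\<And>x. x \<in> S \<Longrightarrow> (\<Sum>y\<in>S. P x y) = 1"
  shows "(\<Sum>u\<in>S. (chain_op S P ^^ t) f u) = (\<Sum>u\<in>S. f u)"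
proof (induction t)
  case (Suc t)
  let ?g = "(chain_op S P ^^ t) f"
  have "(\<Sum>u\<in>S. chain_op S P ?g u) = (\<Sum>y\<in>S. \<Sum>u\<in>S. P u y * ?g y)"
    unfolding chain_op_def by (rule sum.swap)
  also have "\<dots> = (\<Sum>y\<in>S. (\<Sum>u\<in>S. P y u) * ?g y)"
    unfolding sum_distrib_right by (intro sum.cong refl) (simp add: sym)
  also have "\<dots> = (\<Sum>y\<in>S. ?g y)"
    by (simp add: one)
  finally show ?case
    using Suc by simp
qed simp

text \<open>The l1 distance is the pairing of \<open>?q - ?\<pi>\<close> with its own sign
  \<open>s\<close>. Adjointness moves the \<open>t\<close> steps onto \<open>s\<close>, and what
  remains is a difference of two averages of one function \<open>F\<close>, which its oscillation
  bounds.\<close>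

lemma tv_dist_le_of_oscillation:
  assumes fin: "finite S"
    and sym: "\<And>x y. x \<in> S \<Longrightarrow> y \<in> S \<Longrightarrow> P x y = P y x"
    and one: "\<And>x. x \<in> S \<Longrightarrow> (\<Sum>y\<in>S. P x y) = 1"
    and p: "p \<in> distributions S"
    and osc: "\<And>f x y. (\<And>z. \<bar>f z\<bar> \<le> 1) \<Longrightarrow> x \<in> S \<Longrightarrow> y \<in> S \<Longrightarrow>
      (chain_op S P ^^ t) f x - (chain_op S P ^^ t) f y \<le> B"
  shows "tv_dist S ((chain_step S P ^^ t) p) (uniform_dist S) \<le> B / 2"
proof -
  let ?q = "(chain_step S P ^^ t) p" and ?\<pi> = "uniform_dist S"
  define s where "s = (\<lambda>v. sgn (?q v - ?\<pi> v))"
  define F where "F = (chain_op S P ^^ t) s"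
  have p_nonneg: "p u \<ge> 0" if "u \<in> S" for u
    using p that by (simp add: distributions_def)
  have p_sum: "(\<Sum>u\<in>S. p u) = 1"
    using p by (simp add: distributions_def)
  then have "S \<noteq> {}"
    by auto
  then have \<pi>_sum: "(\<Sum>w\<in>S. ?\<pi> w) = 1"
    using fin by (simp add: uniform_dist_def)
  have "(\<Sum>v\<in>S. \<bar>?q v - ?\<pi> v\<bar>) = (\<Sum>v\<in>S. ?q v * s v) - (\<Sum>v\<in>S. ?\<pi> v * s v)"
    unfolding s_def sum_subtractf[symmetric] left_diff_distrib[symmetric]
    by (intro sum.cong refl) (simp add: abs_sgn)
  also have "(\<Sum>v\<in>S. ?q v * s v) = (\<Sum>u\<in>S. p u * F u)"
    by (simp add: sum_chain_step_funpow F_def)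
  also have "(\<Sum>v\<in>S. ?\<pi> v * s v) = (\<Sum>w\<in>S. ?\<pi> w * F w)"
    unfolding uniform_dist_def F_def sum_distrib_left[symmetric]
    by (simp add: sum_chain_op_symmetric[OF sym one])
  \<comment> \<open>Both weights have total mass 1, so the difference of averages is the mean of
    \<open>F u - F w\<close> for independent \<open>u\<close> and \<open>w\<close>.\<close>
  also have "(\<Sum>u\<in>S. p u * F u) - (\<Sum>w\<in>S. ?\<pi> w * F w)
      = (\<Sum>u\<in>S. \<Sum>w\<in>S. p u * ?\<pi> w * (F u - F w))"
  proof -
    have "(\<Sum>u\<in>S. \<Sum>w\<in>S. p u * ?\<pi> w * (F u - F w))
        = (\<Sum>u\<in>S. p u * F u) * (\<Sum>w\<in>S. ?\<pi> w) - (\<Sum>u\<in>S. p u) * (\<Sum>w\<in>S. ?\<pi> w * F w)"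
      unfolding sum_product sum_subtractf[symmetric]
      by (intro sum.cong refl) (simp add: algebra_simps)
    then show ?thesis
      using p_sum \<pi>_sum by simp
  qed
  also have "\<dots> \<le> (\<Sum>u\<in>S. \<Sum>w\<in>S. p u * ?\<pi> w * B)"
    unfolding F_def
    by (intro sum_mono mult_left_mono osc)
       (auto simp: s_def abs_sgn_eq p_nonneg uniform_dist_def)
  also have "\<dots> = (\<Sum>u\<in>S. p u) * (\<Sum>w\<in>S. ?\<pi> w) * B"
    unfolding sum_product by (simp only: sum_distrib_right)
  finally show ?thesis
    unfolding tv_dist_def p_sum \<pi>_sum by simp
qed

lemma mixing_time_le:
  assumes "\<And>p. p \<in> distributions S \<Longrightarrow> tv_dist S ((chain_step S P ^^ t) p) \<pi> \<le> \<epsilon>"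
  shows "mixing_time S P \<pi> \<epsilon> \<le> enat t"
  unfolding mixing_time_def
  by (intro SUP_least INF_lower2[of t]) (auto intro: assms)

section \<open>The lazy grid\<close>

text \<open>Truncation at the ends of the line turns a missing neighbour into a move that stays put,
  so that end points and interior points obey one formula.\<close>

definition step_up :: "nat \<Rightarrow> nat \<Rightarrow> nat" where
  "step_up k a = min k (a + 1)"

definition step_down :: "nat \<Rightarrow> nat" where
  "step_down a = max 1 (a - 1)"

lemma step_up_mem: "a \<in> {1..k} \<Longrightarrow> step_up k a \<in> {1..k}"
  by (auto simp: step_up_def)

lemma step_down_mem: "a \<in> {1..k} \<Longrightarrow> step_down a \<in> {1..k}"
  by (auto simp: step_down_def)

lemma lazy_line_sym: "x \<in> {1..k} \<Longrightarrow> y \<in> {1..k} \<Longrightarrow> lazy_line k x y = lazy_line k y x"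
  by (auto simp: lazy_line_def line_nbrs_def)

text \<open>Up and down have weight 1/4 each and holding has 1/2; at an end the blocked move adds
  the remaining 1/4 to the holding weight.\<close>

lemma sum_lazy_line:
  assumes k: "k \<ge> 2" and a: "a \<in> {1..k}"
  shows "(\<Sum>b\<in>{1..k}. lazy_line k a b * f b) = (f (step_up k a) + f (step_down a) + 2 * f a) / 4"
proof -
  let ?N = "line_nbrs k a"
  have N: "?N \<subseteq> {1..k}" "a \<notin> ?N" "finite ?N"
    by (auto simp: line_nbrs_def)
  have "(\<Sum>b\<in>{1..k}. lazy_line k a b * f b)
      = (\<Sum>b\<in>{1..k}. (if b \<in> ?N then f b / 4 else 0)
          + (if b = a then (1 - real (card ?N) / 4) * f b else 0))"
    using N by (intro sum.cong refl) (auto simp: lazy_line_def)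
  also have "\<dots> = (\<Sum>b\<in>?N. f b / 4) + (1 - real (card ?N) / 4) * f a"
    using N a by (simp add: sum.distrib sum.inter_restrict[symmetric] Int_absorb1)
  also have "\<dots> = (f (step_up k a) + f (step_down a) + 2 * f a) / 4"
  proof -
    consider "a = 1" | "a = k" "a \<noteq> 1" | "1 < a" "a < k"
      using a by fastforce
    then show ?thesis
    proof cases
      case 1
      then have "?N = {2}"
        using k by (auto simp: line_nbrs_def)
      then show ?thesis
        using 1 k by (simp add: step_up_def step_down_def field_simps numeral_2_eq_2)
    next
      case 2
      then have "?N = {k - 1}"
        using k by (auto simp: line_nbrs_def)
      moreover have "step_up k a = k" "step_down a = k - 1"
        using 2 k by (auto simp: step_up_def step_down_def)
      ultimately show ?thesis
        using 2 by (simp add: field_simps)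
    next
      case 3
      then have "?N = {a - 1, a + 1}"
        by (auto simp: line_nbrs_def)
      moreover have "step_up k a = a + 1" "step_down a = a - 1"
        using 3 by (auto simp: step_up_def step_down_def)
      ultimately show ?thesis
        using 3 by (simp add: field_simps)
    qed
  qed
  finally show ?thesis .
qed

lemma product_chain_sym:
  assumes "\<And>a b. a \<in> A \<Longrightarrow> b \<in> A \<Longrightarrow> P a b = P b a"
    and "x \<in> {1..n} \<rightarrow>\<^sub>E A" "y \<in> {1..n} \<rightarrow>\<^sub>E A"
  shows "product_chain n P x y = product_chain n P y x"
proof -
  have "y = x(i := y i) \<longleftrightarrow> x = y(i := x i)" for i
    by (auto simp: fun_eq_iff)
  moreover have "P (x i) (y i) = P (y i) (x i)" if "i \<in> {1..n}" for i
    using assms(1)[OF PiE_mem[OF assms(2) that] PiE_mem[OF assms(3) that]] .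
  ultimately show ?thesis
    unfolding product_chain_def by (intro sum.cong refl) auto
qed

text \<open>For fixed \<open>i\<close>, the points that agree with \<open>x\<close> off
  \<open>i\<close> are the updates \<open>x(i := b)\<close>, one for each \<open>b \<in> A\<close>,
  so the sum over the product space collapses to a sum over \<open>A\<close>.\<close>

lemma chain_op_product_chain:
  fixes n :: nat
  assumes A: "finite A" and x: "x \<in> {1..n} \<rightarrow>\<^sub>E A"
  shows "chain_op ({1..n} \<rightarrow>\<^sub>E A) (product_chain n P) f x
    = (\<Sum>i\<in>{1..n}. \<Sum>b\<in>A. P (x i) b * f (x(i := b))) / real n"
proof -
  let ?G = "{1..n} \<rightarrow>\<^sub>E A"
  have fin: "finite ?G"
    using A by (simp add: finite_PiE)
  have coord: "(\<Sum>y\<in>?G. (if y = x(i := y i) then P (x i) (y i) else 0) * f y)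
      = (\<Sum>b\<in>A. P (x i) b * f (x(i := b)))" if i: "i \<in> {1..n}" for i
  proof -
    have "(\<Sum>y\<in>?G. (if y = x(i := y i) then P (x i) (y i) else 0) * f y)
        = (\<Sum>y\<in>{y \<in> ?G. y = x(i := y i)}. P (x i) (y i) * f y)"
      using fin by (intro sum.mono_neutral_cong_right) auto
    also have "\<dots> = (\<Sum>b\<in>A. P (x i) b * f (x(i := b)))"
    proof (rule sum.reindex_bij_witness[where i = "\<lambda>b. x(i := b)" and j = "\<lambda>y. y i"])
      fix b assume "b \<in> A"
      then show "x(i := b) \<in> {y \<in> ?G. y = x(i := y i)}"
        using x i by (auto simp: PiE_iff extensional_def)
    qed (use i in auto)
    finally show ?thesis .
  qed
  have "chain_op ?G (product_chain n P) f x
      = (\<Sum>i\<in>{1..n}. \<Sum>y\<in>?G. 1 / real n *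
          ((if y = x(i := y i) then P (x i) (y i) else 0) * f y))"
    unfolding chain_op_def product_chain_def sum_distrib_right
    by (subst sum.swap) (simp add: mult.assoc)
  also have "\<dots> = (\<Sum>i\<in>{1..n}. \<Sum>b\<in>A. P (x i) b * f (x(i := b))) / real n"
    by (simp only: sum_distrib_left[symmetric] coord cong: sum.cong) simp
  finally show ?thesis .
qed

abbreviation grid_op :: "nat \<Rightarrow> nat \<Rightarrow> ((nat \<Rightarrow> nat) \<Rightarrow> real) \<Rightarrow> (nat \<Rightarrow> nat) \<Rightarrow> real" where
  "grid_op k n \<equiv> chain_op (grid k n) (lazy_grid k n)"

lemma grid_upd: "x \<in> grid k n \<Longrightarrow> i \<in> {1..n} \<Longrightarrow> b \<in> {1..k} \<Longrightarrow> x(i := b) \<in> grid k n"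
  by (auto simp: grid_def PiE_iff extensional_def)

lemma grid_mem: "x \<in> grid k n \<Longrightarrow> i \<in> {1..n} \<Longrightarrow> x i \<in> {1..k}"
  unfolding grid_def by (rule PiE_mem)

lemma grid_op_eq:
  assumes "k \<ge> 2" "x \<in> grid k n"
  shows "grid_op k n f x = (\<Sum>i\<in>{1..n}.
    (f (x(i := step_up k (x i))) + f (x(i := step_down (x i))) + 2 * f x) / 4) / real n"
proof -
  have "(\<Sum>b\<in>{1..k}. lazy_line k (x i) b * f (x(i := b)))
      = (f (x(i := step_up k (x i))) + f (x(i := step_down (x i))) + 2 * f x) / 4"
    if "i \<in> {1..n}" for i
    using sum_lazy_line[OF assms(1) grid_mem[OF assms(2) that], of "\<lambda>b. f (x(i := b))"] by simp
  then show ?thesis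
    using assms unfolding grid_def lazy_grid_def
    by (simp only: chain_op_product_chain[OF finite_atLeastAtMost] cong: sum.cong)
qed

lemma lazy_grid_row_sum:
  assumes "k \<ge> 2" "n \<ge> 1" "x \<in> grid k n"
  shows "(\<Sum>y\<in>grid k n. lazy_grid k n x y) = 1"
  using grid_op_eq[OF assms(1,3), of "\<lambda>_. 1"] assms(2) by (simp add: chain_op_def)

section \<open>Two walkers on the line\<close>

text \<open>
  The kernel of the coupled pair, killed when the two walkers meet; it is used only for
  \<open>1 \<le> a \<le> b \<le> k\<close>.
\<close>

definition pair_op :: "nat \<Rightarrow> nat \<Rightarrow> (nat \<Rightarrow> nat \<Rightarrow> real) \<Rightarrow> nat \<Rightarrow> nat \<Rightarrow> real" where
  "pair_op k n v a b = (if a = b then 0 else (1 - 1 / real n) * v a b +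
     (v (step_up k a) b + v (step_down a) b + v a (step_up k b) + v a (step_down b))
       / (4 * real n))"

text \<open>The probability that the coupled pair started at \<open>a\<close> and \<open>b\<close>
  has not met within \<open>t\<close> steps.\<close>

definition unmet :: "nat \<Rightarrow> nat \<Rightarrow> nat \<Rightarrow> nat \<Rightarrow> nat \<Rightarrow> real" where
  "unmet k n t = (pair_op k n ^^ t) (\<lambda>a b. if a = b then 0 else 1)"

text \<open>Only one walker moves, and by at most 1, so distinct walkers may meet but cannot
  cross.\<close>

lemma pair_steps:
  assumes "1 \<le> a" "a < b" "b \<le> k"
  shows "1 \<le> step_up k a" "step_up k a \<le> b" "1 \<le> step_down a" "step_down a \<le> b"
    "a \<le> step_up k b" "step_up k b \<le> k" "a \<le> step_down b" "step_down b \<le> k"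
  using assms by (auto simp: step_up_def step_down_def)

text \<open>All weights are nonnegative, and by \<open>pair_steps\<close> only values at ordered
  pairs enter.\<close>

lemma pair_op_mono:
  assumes n: "n \<ge> 1" and ab: "1 \<le> a" "a \<le> b" "b \<le> k"
    and le: "\<And>a b. 1 \<le> a \<Longrightarrow> a \<le> b \<Longrightarrow> b \<le> k \<Longrightarrow> v a b \<le> w a b"
  shows "pair_op k n v a b \<le> pair_op k n w a b"
proof (cases "a = b")
  case False
  then have "a < b"
    using ab by simp
  note st = pair_steps[OF ab(1) this ab(3)]
  have "(1 - 1 / real n) * v a b \<le> (1 - 1 / real n) * w a b"
    using n ab by (intro mult_left_mono le) auto
  moreover have "v (step_up k a) b \<le> w (step_up k a) b" "v (step_down a) b \<le> w (step_down a) b"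
    "v a (step_up k b) \<le> w a (step_up k b)" "v a (step_down b) \<le> w a (step_down b)"
    using st ab by (auto intro!: le)
  ultimately show ?thesis
    using False unfolding pair_op_def
    by (auto intro!: add_mono divide_right_mono)
qed (simp add: pair_op_def)

lemma pair_op_sum:
  "pair_op k n (\<lambda>a b. \<Sum>s\<in>T. v s a b) a b = (\<Sum>s\<in>T. pair_op k n (v s) a b)"
  by (simp add: pair_op_def sum.distrib sum_distrib_left sum_divide_distrib add_divide_distrib)

lemma unmet_Suc: "unmet k n (Suc t) = pair_op k n (unmet k n t)"
  by (simp add: unmet_def)

text \<open>The first step cannot increase the indicator of distinct walkers; monotonicity of
  \<open>pair_op\<close> propagates this inequality to all later times.\<close>

lemma unmet_antimono:
  assumes "n \<ge> 1" "1 \<le> a" "a \<le> b" "b \<le> k" "s \<le> t"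
  shows "unmet k n t a b \<le> unmet k n s a b"
proof -
  have "unmet k n (Suc t) a b \<le> unmet k n t a b" if "1 \<le> a" "a \<le> b" "b \<le> k" for t a b
    using that
  proof (induction t arbitrary: a b)
    case 0
    have "pair_op k n (unmet k n 0) a b \<le> pair_op k n (\<lambda>a b. 1) a b"
      using 0 assms(1) by (intro pair_op_mono) (auto simp: unmet_def)
    also have "\<dots> \<le> unmet k n 0 a b"
      using assms(1) by (simp add: pair_op_def unmet_def)
    finally show ?case
      by (simp add: unmet_Suc)
  next
    case (Suc t)
    then show ?case
      unfolding unmet_Suc[of k n "Suc t"] unmet_Suc[of k n t]
      using assms(1) by (intro pair_op_mono) (auto simp: unmet_Suc[symmetric])
  qed
  then show ?thesis
    using assms(2-5) by (blast intro: lift_Suc_antimono_le[where f = "\<lambda>t. unmet k n t a b"])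
qed

section \<open>Expected meeting time by a Lyapunov function\<close>

text \<open>As a function of the distance it has second difference -2, which gives the drift, and it
  increases up to distance \<open>k\<close>, so that moves blocked at an end do no harm.\<close>

definition meeting_bound :: "nat \<Rightarrow> nat \<Rightarrow> nat \<Rightarrow> real" where
  "meeting_bound k a b = (real b - real a) * (2 * real k - (real b - real a))"

lemma meeting_bound_nonneg: "a \<le> b \<Longrightarrow> b \<le> k \<Longrightarrow> meeting_bound k a b \<ge> 0"
  by (simp add: meeting_bound_def)

lemma meeting_bound_le: "meeting_bound k a b \<le> (real k)\<^sup>2"
proof -
  have "0 \<le> (real k - (real b - real a))\<^sup>2"
    by simp
  then show ?thesis
    by (simp add: meeting_bound_def power2_eq_square algebra_simps)
qed

lemma meeting_bound_drift:
  assumes ab: "1 \<le> a" "a < b" "b \<le> k"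
  shows "meeting_bound k (step_up k a) b + meeting_bound k (step_down a) b
    + meeting_bound k a (step_up k b) + meeting_bound k a (step_down b)
    \<le> 4 * meeting_bound k a b - 4"
proof -
  define d where "d = real b - real a"
  define g where "g = (\<lambda>d. d * (2 * real k - d))"
  have mb: "meeting_bound k x y = g (real y - real x)" for x y
    by (simp add: meeting_bound_def g_def)
  have d: "1 \<le> d" "d + 1 \<le> real k"
    using ab by (auto simp: d_def)
  \<comment> \<open>A blocked outward move leaves the distance at \<open>d\<close>; by this
    inequality it may be charged as a move to \<open>d + 1\<close>.\<close>
  have grow: "g d \<le> g (d + 1)"
    using d by (simp add: g_def algebra_simps)
  have "real b - real (step_up k a) = d - 1" "real (step_down b) - real a = d - 1"
    using ab by (auto simp: d_def step_up_def step_down_def min_def max_def of_nat_diff)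
  moreover have "real b - real (step_down a) = d \<or> real b - real (step_down a) = d + 1"
    using ab by (auto simp: d_def step_down_def max_def of_nat_diff)
  moreover have "real (step_up k b) - real a = d \<or> real (step_up k b) - real a = d + 1"
    using ab by (auto simp: d_def step_up_def min_def)
  ultimately have "meeting_bound k (step_up k a) b + meeting_bound k (step_down a) b
      + meeting_bound k a (step_up k b) + meeting_bound k a (step_down b)
      \<le> 2 * g (d - 1) + 2 * g (d + 1)"
    unfolding mb using grow by auto
  also have "\<dots> = 4 * g d - 4"
    by (simp add: g_def algebra_simps)
  finally show ?thesis
    by (simp add: mb d_def)
qed

text \<open>The sum of the tail probabilities is the expected meeting time truncated at
  \<open>t\<close>. In the first-step recursion, \<open>pair_op\<close> lowers
  \<open>real n * meeting_bound k a b\<close> by at least 1 off the diagonal, which pays for the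
  term \<open>unmet k n 0 a b\<close>.\<close>

lemma sum_unmet_le:
  assumes n: "n \<ge> 1" and ab: "1 \<le> a" "a \<le> b" "b \<le> k"
  shows "(\<Sum>s<t. unmet k n s a b) \<le> real n * meeting_bound k a b"
  using ab
proof (induction t arbitrary: a b)
  case 0
  then show ?case
    by (simp add: meeting_bound_nonneg)
next
  case (Suc t)
  have "(\<Sum>s<Suc t. unmet k n s a b)
      = unmet k n 0 a b + pair_op k n (\<lambda>a b. \<Sum>s<t. unmet k n s a b) a b"
    by (simp add: sum.lessThan_Suc_shift unmet_Suc pair_op_sum del: sum.lessThan_Suc)
  also have "\<dots> \<le> unmet k n 0 a b + pair_op k n (\<lambda>a b. real n * meeting_bound k a b) a b"
    using Suc n by (intro add_left_mono pair_op_mono) auto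
  also have "\<dots> \<le> real n * meeting_bound k a b"
  proof (cases "a = b")
    case True
    then show ?thesis
      by (simp add: unmet_def pair_op_def meeting_bound_def)
  next
    case False
    let ?S = "meeting_bound k (step_up k a) b + meeting_bound k (step_down a) b
      + meeting_bound k a (step_up k b) + meeting_bound k a (step_down b)"
    have "pair_op k n (\<lambda>a b. real n * meeting_bound k a b) a b
        = (real n - 1) * meeting_bound k a b + ?S / 4"
      using False n by (simp add: pair_op_def field_simps)
    moreover have "?S \<le> 4 * meeting_bound k a b - 4"
      using False Suc.prems by (intro meeting_bound_drift) auto
    moreover have "unmet k n 0 a b = 1"
      using False by (simp add: unmet_def)
    ultimately show ?thesis
      by (simp add: left_diff_distrib add_divide_distrib)
  qed
  finally show ?case .
qed

text \<open>Markov's inequality: each of the first \<open>2 * n * k\<^sup>2\<close> tails is at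
  least the last one, while their sum is at most \<open>n * k\<^sup>2\<close>.\<close>

lemma unmet_le_half:
  assumes n: "n \<ge> 1" and ab: "1 \<le> a" "a \<le> b" "b \<le> k"
  shows "unmet k n (2 * n * k\<^sup>2) a b \<le> 1 / 2"
proof -
  let ?t = "2 * n * k\<^sup>2"
  have "real ?t * unmet k n ?t a b = (\<Sum>s<?t. unmet k n ?t a b)"
    by simp
  also have "\<dots> \<le> (\<Sum>s<?t. unmet k n s a b)"
    using assms by (intro sum_mono unmet_antimono) auto
  also have "\<dots> \<le> real n * meeting_bound k a b"
    using assms by (rule sum_unmet_le)
  also have "\<dots> \<le> real n * (real k)\<^sup>2"
    by (intro mult_left_mono meeting_bound_le) simp
  finally have "(real n * (real k)\<^sup>2) * (2 * unmet k n ?t a b) \<le> (real n * (real k)\<^sup>2) * 1"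
    by (simp add: mult_ac)
  moreover have "real n * (real k)\<^sup>2 > 0"
    using n ab by simp
  ultimately show ?thesis
    by (simp only: mult_le_cancel_left_pos)
qed

section \<open>Contraction of coordinate oscillations\<close>

text \<open>One step of the coupling: if \<open>v\<close> bounds the change of \<open>f\<close>
  between two values of coordinate \<open>i\<close>, then \<open>pair_op k n v\<close> does so for
  the image of \<open>f\<close>.\<close>

lemma grid_op_coordinate_bound:
  assumes k: "k \<ge> 2" and n: "n \<ge> 1" and i: "i \<in> {1..n}"
    and f: "\<And>x b. x \<in> grid k n \<Longrightarrow> b \<in> {1..k} \<Longrightarrow> x i \<le> b \<Longrightarrow> \<bar>f x - f (x(i := b))\<bar> \<le> v (x i) b"
    and x: "x \<in> grid k n" and b: "b \<in> {1..k}" and le: "x i \<le> b"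
  shows "\<bar>grid_op k n f x - grid_op k n f (x(i := b))\<bar> \<le> pair_op k n v (x i) b"
proof (cases "x i = b")
  case True
  then have "x(i := b) = x"
    by auto
  then show ?thesis
    using True by (simp add: pair_op_def)
next
  case False
  let ?y = "x(i := b)"
  define T where "T = (\<lambda>z j. (f (z(j := step_up k (z j))) + f (z(j := step_down (z j))) + 2 * f z) / 4)"
  have xi: "x i \<in> {1..k}"
    using grid_mem[OF x i] .
  have y: "?y \<in> grid k n"
    using grid_upd[OF x i b] .
  have ab: "1 \<le> x i" "x i < b" "b \<le> k"
    using xi b le False by auto
  note st = pair_steps[OF ab]
  \<comment> \<open>Updates at \<open>j\<close> and \<open>i\<close> commute, so after a common move
    at \<open>j\<close> the two points still differ only at \<open>i\<close>, with the same two
    values there.\<close>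
  have other: "\<bar>T x j - T ?y j\<bar> \<le> v (x i) b" if j: "j \<in> {1..n} - {i}" for j
  proof -
    have xj: "x j \<in> {1..k}"
      using grid_mem[OF x] j by auto
    have "\<bar>f (x(j := c)) - f (?y(j := c))\<bar> \<le> v (x i) b" if "c \<in> {1..k}" for c
      using f[of "x(j := c)" b] grid_upd[OF x _ that, of j] b le j
      by (simp add: fun_upd_twist)
    note this[OF step_up_mem[OF xj]] this[OF step_down_mem[OF xj]]
    moreover have "\<bar>f x - f ?y\<bar> \<le> v (x i) b"
      using f[OF x b le] .
    ultimately show ?thesis
      using j unfolding T_def abs_le_iff by (simp add: field_simps)
  qed
  \<comment> \<open>The holding weight 1/2 of each point is matched with the two moves of the other:
    each moved \<open>x\<close> is compared with \<open>?y\<close>, and \<open>x\<close> with each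
    moved \<open>?y\<close>.\<close>
  have same: "\<bar>T x i - T ?y i\<bar>
      \<le> (v (step_up k (x i)) b + v (step_down (x i)) b + v (x i) (step_up k b) + v (x i) (step_down b)) / 4"
  proof -
    have "\<bar>f (x(i := c)) - f ?y\<bar> \<le> v c b" if "c \<in> {1..k}" "c \<le> b" for c
      using f[of "x(i := c)" b] grid_upd[OF x i] that b by simp
    moreover have "\<bar>f x - f (x(i := c))\<bar> \<le> v (x i) c" if "c \<in> {1..k}" "x i \<le> c" for c
      using f[OF x] that by simp
    ultimately have "\<bar>f (x(i := step_up k (x i))) - f ?y\<bar> \<le> v (step_up k (x i)) b"
      "\<bar>f (x(i := step_down (x i))) - f ?y\<bar> \<le> v (step_down (x i)) b"
      "\<bar>f x - f (x(i := step_up k b))\<bar> \<le> v (x i) (step_up k b)"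
      "\<bar>f x - f (x(i := step_down b))\<bar> \<le> v (x i) (step_down b)"
      using st step_up_mem[OF xi] step_down_mem[OF xi] step_up_mem[OF b] step_down_mem[OF b]
      by auto
    then show ?thesis
      unfolding T_def abs_le_iff by (simp add: field_simps)
  qed
  have n_pos: "real n > 0"
    using n by simp
  have "\<bar>(\<Sum>j\<in>{1..n}. T x j) - (\<Sum>j\<in>{1..n}. T ?y j)\<bar> \<le> (\<Sum>j\<in>{1..n}. \<bar>T x j - T ?y j\<bar>)"
    unfolding sum_subtractf[symmetric] by (rule sum_abs)
  also have "\<dots> = \<bar>T x i - T ?y i\<bar> + (\<Sum>j\<in>{1..n} - {i}. \<bar>T x j - T ?y j\<bar>)"
    using i by (intro sum.remove) auto
  also have "\<dots> \<le> (v (step_up k (x i)) b + v (step_down (x i)) b + v (x i) (step_up k b)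
      + v (x i) (step_down b)) / 4 + (\<Sum>j\<in>{1..n} - {i}. v (x i) b)"
    by (intro add_mono same sum_mono other)
  also have "(\<Sum>j\<in>{1..n} - {i}. v (x i) b) = (real n - 1) * v (x i) b"
    using i n by (simp add: of_nat_diff)
  finally have "\<bar>(\<Sum>j\<in>{1..n}. T x j) - (\<Sum>j\<in>{1..n}. T ?y j)\<bar> / real n
    \<le> ((v (step_up k (x i)) b + v (step_down (x i)) b + v (x i) (step_up k b)
        + v (x i) (step_down b)) / 4 + (real n - 1) * v (x i) b) / real n"
    by (rule divide_right_mono) simp
  also have "\<dots> = pair_op k n v (x i) b"
  proof -
    have "(S / 4 + (real n - 1) * w) / real n = (1 - 1 / real n) * w + S / (4 * real n)" for S w
      using n_pos by (simp add: field_simps)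
    then show ?thesis
      using False by (simp only: pair_op_def if_False)
  qed
  finally have bound: "\<bar>(\<Sum>j\<in>{1..n}. T x j) - (\<Sum>j\<in>{1..n}. T ?y j)\<bar> / real n
    \<le> pair_op k n v (x i) b" .
  have "grid_op k n f z = (\<Sum>j\<in>{1..n}. T z j) / real n" if "z \<in> grid k n" for z
    using grid_op_eq[OF k that] by (simp add: T_def)
  from this[OF x] this[OF y] have "\<bar>grid_op k n f x - grid_op k n f ?y\<bar>
      = \<bar>(\<Sum>j\<in>{1..n}. T x j) - (\<Sum>j\<in>{1..n}. T ?y j)\<bar> / real n"
    by (simp only: diff_divide_distrib[symmetric] abs_divide abs_of_nat)
  with bound show ?thesis
    by simp
qed

definition coord_osc_le :: "nat \<Rightarrow> nat \<Rightarrow> real \<Rightarrow> ((nat \<Rightarrow> nat) \<Rightarrow> real) \<Rightarrow> bool" where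
  "coord_osc_le k n M f \<longleftrightarrow>
     (\<forall>x\<in>grid k n. \<forall>i\<in>{1..n}. \<forall>b\<in>{1..k}. \<bar>f x - f (x(i := b))\<bar> \<le> M)"

text \<open>At time 0 the bound is \<open>M\<close> times the indicator of distinct values; every
  further step applies \<open>pair_op\<close>.\<close>

lemma grid_op_funpow_coordinate_bound:
  assumes k: "k \<ge> 2" and n: "n \<ge> 1" and i: "i \<in> {1..n}"
    and f: "coord_osc_le k n M f"
    and x: "x \<in> grid k n" and b: "b \<in> {1..k}" and le: "x i \<le> b"
  shows "\<bar>(grid_op k n ^^ t) f x - (grid_op k n ^^ t) f (x(i := b))\<bar> \<le> M * unmet k n t (x i) b"
  using x b le
proof (induction t arbitrary: x b)
  case 0
  have "\<bar>f x - f (x(i := b))\<bar> \<le> M"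
    using f i 0 by (simp add: coord_osc_le_def)
  moreover have "x(i := b) = x" if "x i = b"
    using that by auto
  ultimately show ?case
    by (cases "x i = b") (simp_all add: unmet_def del: fun_upd_apply)
next
  case (Suc t)
  have "\<bar>(grid_op k n ^^ Suc t) f x - (grid_op k n ^^ Suc t) f (x(i := b))\<bar>
      \<le> pair_op k n (\<lambda>a b. M * unmet k n t a b) (x i) b"
    using grid_op_coordinate_bound[OF k n i Suc.IH Suc.prems] by simp
  also have "\<dots> = M * unmet k n (Suc t) (x i) b"
    by (simp add: unmet_Suc pair_op_def algebra_simps add_divide_distrib)
  finally show ?case .
qed

lemma coord_osc_le_halve:
  assumes k: "k \<ge> 2" and n: "n \<ge> 1" and M: "M \<ge> 0" and f: "coord_osc_le k n M f"
  shows "coord_osc_le k n (M / 2) ((grid_op k n ^^ (2 * n * k\<^sup>2)) f)"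
proof -
  let ?g = "(grid_op k n ^^ (2 * n * k\<^sup>2)) f"
  have ordered: "\<bar>?g x - ?g (x(i := b))\<bar> \<le> M / 2"
    if x: "x \<in> grid k n" and i: "i \<in> {1..n}" and b: "b \<in> {1..k}" "x i \<le> b" for x i b
  proof -
    have "\<bar>?g x - ?g (x(i := b))\<bar> \<le> M * unmet k n (2 * n * k\<^sup>2) (x i) b"
      using grid_op_funpow_coordinate_bound[OF k n i f x b] .
    also have "\<dots> \<le> M * (1 / 2)"
      using grid_mem[OF x i] b n M by (intro mult_left_mono unmet_le_half) auto
    finally show ?thesis
      by simp
  qed
  have "\<bar>?g x - ?g (x(i := b))\<bar> \<le> M / 2"
    if x: "x \<in> grid k n" and i: "i \<in> {1..n}" and b: "b \<in> {1..k}" for x i b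
  proof (cases "x i \<le> b")
    \<comment> \<open>The roles are exchanged: updating \<open>x(i := b)\<close> at \<open>i\<close>
      by the larger value \<open>x i\<close> gives back \<open>x\<close>.\<close>
    case False
    then show ?thesis
      using ordered[OF grid_upd[OF x i b] i grid_mem[OF x i]] by (simp add: abs_minus_commute)
  qed (use ordered that in auto)
  then show ?thesis
    by (simp add: coord_osc_le_def)
qed

lemma coord_osc_le_funpow:
  assumes "k \<ge> 2" "n \<ge> 1" "M \<ge> 0" "coord_osc_le k n M f"
  shows "coord_osc_le k n (M / 2 ^ m) ((grid_op k n ^^ (m * (2 * n * k\<^sup>2))) f)"
proof (induction m)
  case 0
  then show ?case
    using assms by simp
next
  case (Suc m)
  then show ?case
    using coord_osc_le_halve[OF assms(1,2) _ Suc] assms(3) by (simp add: funpow_add field_simps)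
qed

section \<open>From coordinate oscillations to the mixing time\<close>

lemma coord_osc_le_oscillation:
  assumes f: "coord_osc_le k n M f" and x: "x \<in> grid k n" and y: "y \<in> grid k n"
  shows "f x - f y \<le> real n * M"
proof -
  \<comment> \<open>A path from \<open>x\<close> to \<open>y\<close> that replaces the coordinates
    \<open>1, ..., n\<close> one after the other.\<close>
  define z where "z = (\<lambda>m. \<lambda>i. if i \<le> m then y i else x i)"
  have z: "z m \<in> grid k n" for m
    using x y by (auto simp: z_def grid_def PiE_iff extensional_def)
  have step: "z (Suc m) = (z m)(Suc m := y (Suc m))" for m
    by (auto simp: z_def fun_eq_iff)
  have "f (z 0) - f (z m) \<le> real m * M" if "m \<le> n" for m
    using that
  proof (induction m)
    case (Suc m)
    have "f (z m) - f (z (Suc m)) \<le> M"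
      using f z[of m] grid_mem[OF y, of "Suc m"] Suc.prems
      unfolding coord_osc_le_def step by (fastforce dest!: bspec)
    then show ?case
      using Suc by (simp add: algebra_simps)
  qed simp
  \<comment> \<open>Index 0 and the indices beyond \<open>n\<close> cause no discrepancy:
    \<open>x\<close> and \<open>y\<close> are both \<open>undefined\<close> there.\<close>
  moreover have "z 0 = x" "z n = y"
    using x y by (auto simp: z_def grid_def PiE_iff extensional_def fun_eq_iff)
  ultimately show ?thesis
    by auto
qed

text \<open>A test function bounded by 1 has coordinate oscillations at most 2. After
  \<open>m\<close> halving blocks its total oscillation is at most \<open>n * 2 / 2 ^ m\<close>,
  hence at most 1/2, and duality halves this once more.\<close>

lemma grid_mixing_time_le:
  assumes k: "k \<ge> 2" and n: "n \<ge> 1" and m: "4 * n \<le> 2 ^ m"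
  shows "grid_mixing_time k n (1 / 4) \<le> enat (m * (2 * n * k\<^sup>2))"
  unfolding grid_mixing_time_def
proof (rule mixing_time_le)
  fix p assume p: "p \<in> distributions (grid k n)"
  let ?t = "m * (2 * n * k\<^sup>2)"
  have "tv_dist (grid k n) ((chain_step (grid k n) (lazy_grid k n) ^^ ?t) p) (uniform_dist (grid k n))
      \<le> (1 / 2) / 2"
  proof (rule tv_dist_le_of_oscillation)
    show "finite (grid k n)"
      by (simp add: grid_def finite_PiE)
    show "lazy_grid k n x y = lazy_grid k n y x" if "x \<in> grid k n" "y \<in> grid k n" for x y
      using product_chain_sym[of "{1..k}" "lazy_line k"] lazy_line_sym that
      unfolding lazy_grid_def grid_def by blast
    show "(\<Sum>y\<in>grid k n. lazy_grid k n x y) = 1" if "x \<in> grid k n" for x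
      using lazy_grid_row_sum[OF k n that] .
    fix f :: "(nat \<Rightarrow> nat) \<Rightarrow> real" and x y
    assume f: "\<And>z. \<bar>f z\<bar> \<le> 1" and xy: "x \<in> grid k n" "y \<in> grid k n"
    have "\<bar>f z - f w\<bar> \<le> 2" for z w
      using f[of z] f[of w] by linarith
    then have "coord_osc_le k n 2 f"
      by (simp add: coord_osc_le_def)
    then have "coord_osc_le k n (2 / 2 ^ m) ((grid_op k n ^^ ?t) f)"
      using k n by (intro coord_osc_le_funpow) auto
    from coord_osc_le_oscillation[OF this xy]
    have "(grid_op k n ^^ ?t) f x - (grid_op k n ^^ ?t) f y \<le> real n * (2 / 2 ^ m)" .
    also have "real (4 * n) \<le> real (2 ^ m)"
      using m by (rule of_nat_mono)
    then have "real n * (2 / 2 ^ m) \<le> 1 / 2"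
      by (simp add: field_simps)
    finally show "(grid_op k n ^^ ?t) f x - (grid_op k n ^^ ?t) f y \<le> 1 / 2" .
  qed (rule p)
  then show "tv_dist (grid k n) ((chain_step (grid k n) (lazy_grid k n) ^^ ?t) p)
      (uniform_dist (grid k n)) \<le> 1 / 4"
    by simp
qed

theorem corollary5p3:
  shows "\<exists>C::real. C > 0 \<and> (\<forall>k n :: nat. k \<ge> 2 \<longrightarrow> n \<ge> 2 \<longrightarrow>
    ereal_of_enat (grid_mixing_time k n (1 / 4))
      \<le> ereal (C * (real k)\<^sup>2 * real n * (ln (real n))\<^sup>2))"
proof (intro exI conjI allI impI)
  show "(8 / (ln 2)\<^sup>2 :: real) > 0"
    by simp
  fix k n :: nat
  assume k: "k \<ge> 2" and n: "n \<ge> 2"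
  define L where "L = log 2 (real n)"
  have L: "L \<ge> 1"
    using n by (simp add: L_def le_log_iff)
  \<comment> \<open>The summand 2 supplies the factor 4 in \<open>4 * n \<le> 2 ^ m\<close>.\<close>
  define m where "m = nat \<lceil>L\<rceil> + 2"
  have "real n = 2 powr L"
    using n by (simp add: L_def)
  also have "\<dots> \<le> 2 powr real (nat \<lceil>L\<rceil>)"
    by (intro powr_mono) (auto intro: real_nat_ceiling_ge)
  finally have "real n \<le> real (2 ^ nat \<lceil>L\<rceil>)"
    by (simp add: powr_realpow)
  then have "n \<le> 2 ^ nat \<lceil>L\<rceil>"
    by (simp only: of_nat_le_iff)
  then have "4 * n \<le> 2 ^ m"
    by (simp add: m_def power_add)
  then have "grid_mixing_time k n (1 / 4) \<le> enat (m * (2 * n * k\<^sup>2))"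
    using k n by (intro grid_mixing_time_le) auto
  then have "ereal_of_enat (grid_mixing_time k n (1 / 4)) \<le> ereal (real (m * (2 * n * k\<^sup>2)))"
    using ereal_of_enat_le_iff[of "grid_mixing_time k n (1 / 4)" "enat (m * (2 * n * k\<^sup>2))"] by simp
  also have "real (m * (2 * n * k\<^sup>2)) \<le> (8 / (ln 2)\<^sup>2) * (real k)\<^sup>2 * real n * (ln (real n))\<^sup>2"
  proof -
    \<comment> \<open>The number of blocks is linear in \<open>L\<close>; as
      \<open>L \<ge> 1\<close>, it is at most \<open>4 * L\<^sup>2\<close>. With the factor 2 of the
      block length and the change to natural logarithms this gives the constant
      \<open>8 / (ln 2)\<^sup>2\<close>.\<close>
    have "real m \<le> L + 3"
      using L unfolding m_def by linarith
    also have "\<dots> \<le> 4 * L"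
      using L by simp
    also have "\<dots> \<le> 4 * L\<^sup>2"
      using L by (simp add: power2_eq_square)
    finally have "real m * (2 * real n * (real k)\<^sup>2) \<le> 4 * L\<^sup>2 * (2 * real n * (real k)\<^sup>2)"
      by (intro mult_right_mono) auto
    then show ?thesis
      by (simp add: L_def log_def power_divide mult_ac)
  qed
  finally show "ereal_of_enat (grid_mixing_time k n (1 / 4))
      \<le> ereal (8 / (ln 2)\<^sup>2 * (real k)\<^sup>2 * real n * (ln (real n))\<^sup>2)"
    by simp
qed

end
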